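(* Let $X$ and $Y$ be metric spaces and let $f\colon X\to Y$ be a function. Then: (i) $\mathbb{L}(f)$ is an open set; (ii) $\mathbb{L}^\infty(f)$ is a closed set.
   Context: The metric on a metric space $X$ is written $|\cdot-\cdot|_X$, and $B(x,r)=\{u\in X: |u-x|_X<r\}$. For $f\colon X\to Y$ and $x\in X$, the local Lipschitz derivative is $\mathbb{L}\mathrm{ip} f(x)=\limsup_{(u,v)\to(x,x)}\frac{|f(u)-f(v)|_Y}{|u-v|_X}=\inf_{r>0}\sup_{u\ne v\in B(x,r)}\frac{|f(u)-f(v)|_Y}{|u-v|_X}\in[0,+\infty]$, with the convention $\sup\varnothing=0$. Denote $\mathbb{L}(f)=\{x\in X:\mathbb{L}\mathrm{ip} f(x)<\infty\}$ and $\mathbb{L}^\infty(f)=\{x\in X:\mathbb{L}\mathrm{ip} f(x)=\infty\}$. "Open" and "closed" are meant in $X$. *)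

theory Defs
  imports "HOL-Analysis.Abstract_Metric_Spaces" "HOL-Library.Extended_Nonnegative_Real"
begin

text \<open>Metric spaces are elements of the library type \<open>'a metric\<close>, so a space has an arbitrary
  (possibly empty) carrier \<^term>\<open>mspace X\<close>. Values are taken in \<^typ>\<open>ennreal\<close>, where
  the supremum of the empty set is 0, as the convention for isolated points requires.\<close>

definition Lip :: "'a metric \<Rightarrow> 'b metric \<Rightarrow> ('a \<Rightarrow> 'b) \<Rightarrow> 'a \<Rightarrow> ennreal" where
  "Lip X Y f x =
     (INF r\<in>{0<..}. SUP (u, v)\<in>{(u, v). u \<in> mball_of X x r \<and> v \<in> mball_of X x r \<and> u \<noteq> v}.
        ennreal (mdist Y (f u) (f v) / mdist X u v))"

definition Lip_finite_set :: "'a metric \<Rightarrow> 'b metric \<Rightarrow> ('a \<Rightarrow> 'b) \<Rightarrow> 'a set" where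
  "Lip_finite_set X Y f = {x \<in> mspace X. Lip X Y f x < \<infinity>}"

definition Lip_infinite_set :: "'a metric \<Rightarrow> 'b metric \<Rightarrow> ('a \<Rightarrow> 'b) \<Rightarrow> 'a set" where
  "Lip_infinite_set X Y f = {x \<in> mspace X. Lip X Y f x = \<infinity>}"

end

theory Submission
  imports Defs
begin

text \<open>Finiteness of the local Lipschitz derivative at \<open>x\<close> is witnessed by a
  single ball: on some ball about \<open>x\<close> the difference quotients have a finite supremum.
  Every point \<open>y\<close> of that ball is the centre of a smaller ball inside it
  (\<open>mball_of_mono_centre\<close>), over which the supremum can only be smaller, so the
  derivative is finite at \<open>y\<close> too. Hence the whole ball lies in the finiteness set,
  which is therefore open; the infinity set is its complement.\<close>

text \<open>Triangle inequality through \<open>y\<close>: the subtracted distance pays for moving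
  the centre.\<close>

lemma mball_of_mono_centre:
  assumes "y \<in> mball_of X x r"
  shows "mball_of X y (r - mdist X x y) \<subseteq> mball_of X x r"
proof
  fix u assume "u \<in> mball_of X y (r - mdist X x y)"
  then show "u \<in> mball_of X x r"
    using assms mdist_triangle[of x X y u] by (auto simp: in_mball_of)
qed

lemma openin_Lip_finite_set: "openin (mtopology_of X) (Lip_finite_set X Y f)"
proof -
  interpret Metric_space "mspace X" "mdist X" by (rule Metric_space_mspace_mdist)
  define S where "S = (\<lambda>x r. SUP (u, v)\<in>{(u, v). u \<in> mball_of X x r \<and> v \<in> mball_of X x r \<and> u \<noteq> v}.
        ennreal (mdist Y (f u) (f v) / mdist X u v))"
  have Lip_S: "Lip X Y f x = (INF r\<in>{0<..}. S x r)" for x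
    by (simp add: Lip_def S_def)
  have "\<exists>r>0. mball_of X x r \<subseteq> Lip_finite_set X Y f" if x: "x \<in> Lip_finite_set X Y f" for x
  proof -
    \<comment> \<open>An infimum strictly below \<infinity> has a member below \<infinity>, which
      supplies the radius.\<close>
    obtain r where r: "r > 0" "S x r < \<infinity>"
      using x by (auto simp: Lip_finite_set_def Lip_S INF_less_iff simp del: infinity_ennreal_def)
    have "y \<in> Lip_finite_set X Y f" if y: "y \<in> mball_of X x r" for y
    proof -
      have "0 < r - mdist X x y"
        using y by (simp add: in_mball_of)
      then have "Lip X Y f y \<le> S y (r - mdist X x y)"
        unfolding Lip_S by (intro INF_lower) simp
      \<comment> \<open>Pairs from the smaller ball are among the pairs from the larger one.\<close>
      also have "\<dots> \<le> S x r"
        unfolding S_def using mball_of_mono_centre[OF y] by (intro SUP_subset_mono) auto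
      finally show ?thesis
        using r y by (auto simp: Lip_finite_set_def in_mball_of)
    qed
    with r show ?thesis by blast
  qed
  moreover have "Lip_finite_set X Y f \<subseteq> mspace X"
    by (auto simp: Lip_finite_set_def)
  ultimately show ?thesis
    by (simp add: mtopology_of_def openin_mtopology mball_of_def)
qed

theorem corollary5p7:
  fixes X :: "'a metric" and Y :: "'b metric" and f :: "'a \<Rightarrow> 'b"
  assumes "f \<in> mspace X \<rightarrow> mspace Y"
  shows "openin (mtopology_of X) (Lip_finite_set X Y f)
       \<and> closedin (mtopology_of X) (Lip_infinite_set X Y f)"
proof
  show "openin (mtopology_of X) (Lip_finite_set X Y f)"
    by (rule openin_Lip_finite_set)
  \<comment> \<open>In \<open>ennreal\<close> a value is either below the top element or equal to
    it, so the two sets partition the carrier.\<close>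
  have "Lip_infinite_set X Y f = topspace (mtopology_of X) - Lip_finite_set X Y f"
    by (auto simp: Lip_infinite_set_def Lip_finite_set_def less_top[symmetric])
  then show "closedin (mtopology_of X) (Lip_infinite_set X Y f)"
    using openin_Lip_finite_set by (metis closedin_diff closedin_topspace)
qed

end
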